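(* The Bloch space $\mathcal{B}$ is not dense in the space $X$, where $X$ is equipped with its norm $\|\cdot\|_X$.
   Context: Let $\mathbb{D}=\{z\in\mathbb{C}:|z|<1\}$, let $H(\mathbb{D})$ be the space of analytic functions on $\mathbb{D}$, and let $dA$ be the area measure on $\mathbb{D}$ normalized so that $A(\mathbb{D})=1$. For $f\in H(\mathbb{D})$ put $\|f\|_{A^1}=\int_{\mathbb{D}}|f(z)|\,dA(z)$. For $w\in\mathbb{D}$ let $k_w(z)=\frac{1}{(1-\overline{w}z)^2}$, $z\in\mathbb{D}$ (the reproducing kernel of the Bergman space $A^2$). The space $X$ consists of all $f\in H(\mathbb{D})$ with $$\|f\|_X=\sup_{z\in\mathbb{D}}|f(z)|\,\|k_z\|_{A^1}^{-1}<\infty.$$ The Bloch space $\mathcal{B}$ consists of all $f\in H(\mathbb{D})$ with $\sup_{z\in\mathbb{D}}(1-|z|^2)|f'(z)|<\infty$. It is known that $\mathcal{B}\subsetneq X$. *)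

theory Defs
  imports "HOL-Analysis.Analysis"
begin

abbreviation unit_disc :: "complex set" where
  "unit_disc \<equiv> ball 0 1"

text \<open>
  A function on the disc is a total function vanishing off the disc, so that two elements
  are equal iff they agree on the disc and the norm below separates points.
\<close>
definition analytic_on_disc :: "(complex \<Rightarrow> complex) set" where
  "analytic_on_disc = {f. f holomorphic_on unit_disc \<and> (\<forall>z. z \<notin> unit_disc \<longrightarrow> f z = 0)}"

definition area_measure :: "complex measure" where
  "area_measure = uniform_measure lborel unit_disc"

text \<open>
  The Bochner integral is 0 when the integrand is not integrable, so this is the norm only
  for integrable \<open>f\<close>. It is applied below only to kernels, which are bounded on the disc
  (see \<open>integrable_bergman_kernel\<close>).
\<close>
definition A1_norm :: "(complex \<Rightarrow> complex) \<Rightarrow> real" where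
  "A1_norm f = (\<integral>z. cmod (f z) \<partial>area_measure)"

definition bergman_kernel :: "complex \<Rightarrow> complex \<Rightarrow> complex" where
  "bergman_kernel w z = 1 / (1 - cnj w * z)^2"

definition X_space :: "(complex \<Rightarrow> complex) set" where
  "X_space = {f \<in> analytic_on_disc.
     bdd_above ((\<lambda>z. cmod (f z) * inverse (A1_norm (bergman_kernel z))) ` unit_disc)}"

definition X_norm :: "(complex \<Rightarrow> complex) \<Rightarrow> real" where
  "X_norm f = (SUP z\<in>unit_disc. cmod (f z) * inverse (A1_norm (bergman_kernel z)))"

text \<open>
  The value 0 off the carrier is immaterial to the topology, but the locale
  \<open>Metric_space\<close> asks for nonnegativity and symmetry there too, and the supremum of an
  unbounded set of reals is unspecified.
\<close>
definition X_dist :: "(complex \<Rightarrow> complex) \<Rightarrow> (complex \<Rightarrow> complex) \<Rightarrow> real" where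
  "X_dist f g = (if f \<in> X_space \<and> g \<in> X_space then X_norm (\<lambda>z. f z - g z) else 0)"

definition X_topology :: "(complex \<Rightarrow> complex) topology" where
  "X_topology = Metric_space.mtopology X_space X_dist"

definition bloch_space :: "(complex \<Rightarrow> complex) set" where
  "bloch_space = {f \<in> analytic_on_disc.
     bdd_above ((\<lambda>z. (1 - (cmod z)^2) * cmod (deriv f z)) ` unit_disc)}"


lemma emeasure_area_disc: "emeasure area_measure unit_disc = 1"
  unfolding area_measure_def
proof (rule emeasure_uniform_measure_1)
  show "emeasure lborel unit_disc \<noteq> \<infinity>"
    using emeasure_lborel_ball_finite[of "0::complex" 1] by simp
  show "emeasure lborel unit_disc \<noteq> 0"
    using emeasure_lborel_ball_finite[of "0::complex" 1] content_ball_pos[of 1 "0::complex"]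
    by (auto simp: measure_def)
qed

lemma emeasure_area_space: "emeasure area_measure (space area_measure) = 1"
  using emeasure_area_disc by (simp add: area_measure_def)

lemma AE_area_disc: "AE z in area_measure. z \<in> unit_disc"
  unfolding area_measure_def by (rule AE_uniform_measureI) auto

lemma bergman_denominator_bounds:
  assumes w: "w \<in> unit_disc" and z: "z \<in> unit_disc"
  shows "1 - cmod w \<le> cmod (1 - cnj w * z)" "cmod (1 - cnj w * z) \<le> 2"
proof -
  have wz: "cmod (cnj w * z) \<le> cmod w"
    using z by (simp add: norm_mult mult_left_le)
  show "1 - cmod w \<le> cmod (1 - cnj w * z)"
    using norm_triangle_ineq2[of 1 "cnj w * z"] wz by simp
  show "cmod (1 - cnj w * z) \<le> 2"
    using norm_triangle_ineq4[of 1 "cnj w * z"] wz w by simp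
qed

lemma integrable_bergman_kernel:
  assumes w: "w \<in> unit_disc"
  shows "integrable area_measure (bergman_kernel w)"
proof -
  interpret finite_measure area_measure
    by standard (simp add: emeasure_area_space)
  have "AE z in area_measure. cmod (bergman_kernel w z) \<le> 1 / (1 - cmod w)^2"
    using AE_area_disc
  proof eventually_elim
    case (elim z)
    have "1 / cmod (1 - cnj w * z)^2 \<le> 1 / (1 - cmod w)^2"
      using bergman_denominator_bounds(1)[OF w elim] w
      by (intro divide_left_mono power_mono mult_pos_pos zero_less_power) auto
    then show ?case
      by (simp add: bergman_kernel_def norm_divide norm_power)
  qed
  moreover have "bergman_kernel w \<in> borel_measurable area_measure"
    unfolding bergman_kernel_def area_measure_def by measurable
  ultimately show ?thesis
    by (rule integrable_const_bound)
qed

lemma A1_norm_bergman_kernel_pos: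
  assumes w: "w \<in> unit_disc"
  shows "0 < A1_norm (bergman_kernel w)"
proof -
  interpret finite_measure area_measure
    by standard (simp add: emeasure_area_space)
  have "(\<integral>z. 1 / 4 \<partial>area_measure) \<le> A1_norm (bergman_kernel w)"
    unfolding A1_norm_def
  proof (rule integral_mono_AE)
    show "integrable area_measure (\<lambda>z. cmod (bergman_kernel w z))"
      using integrable_bergman_kernel[OF w] by simp
    show "AE z in area_measure. 1 / 4 \<le> cmod (bergman_kernel w z)"
      using AE_area_disc
    proof eventually_elim
      case (elim z)
      have "cmod (1 - cnj w * z) > 0"
      proof (rule less_le_trans)
        show "0 < 1 - cmod w" using w by simp
      qed (rule bergman_denominator_bounds(1)[OF w elim])
      moreover have "cmod (1 - cnj w * z)^2 \<le> 2^2"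
        using bergman_denominator_bounds(2)[OF w elim] by (intro power_mono) auto
      ultimately show ?case
        by (simp add: bergman_kernel_def norm_divide norm_power field_simps)
    qed
  qed simp
  then show ?thesis
    by (simp add: measure_def emeasure_area_space)
qed

lemma bdd_above_X_space_diff:
  assumes "f \<in> X_space" "g \<in> X_space"
  shows "bdd_above ((\<lambda>z. cmod (f z - g z) * inverse (A1_norm (bergman_kernel z))) ` unit_disc)"
proof -
  obtain M N where
    M: "\<And>z. z \<in> unit_disc \<Longrightarrow> cmod (f z) * inverse (A1_norm (bergman_kernel z)) \<le> M" and
    N: "\<And>z. z \<in> unit_disc \<Longrightarrow> cmod (g z) * inverse (A1_norm (bergman_kernel z)) \<le> N"
    using assms unfolding X_space_def bdd_above_def by fast
  have "cmod (f z - g z) * inverse (A1_norm (bergman_kernel z)) \<le> M + N"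
    if z: "z \<in> unit_disc" for z
  proof -
    have "cmod (f z - g z) * inverse (A1_norm (bergman_kernel z))
        \<le> (cmod (f z) + cmod (g z)) * inverse (A1_norm (bergman_kernel z))"
      using A1_norm_bergman_kernel_pos[OF z]
      by (intro mult_right_mono norm_triangle_ineq4) auto
    with M[OF z] N[OF z] show ?thesis by (simp add: distrib_right)
  qed
  then show ?thesis by (intro bdd_aboveI2) auto
qed

lemma X_dist_upper:
  assumes "f \<in> X_space" "g \<in> X_space" "z \<in> unit_disc"
  shows "cmod (f z - g z) * inverse (A1_norm (bergman_kernel z)) \<le> X_dist f g"
proof -
  have "X_dist f g = (SUP z\<in>unit_disc. cmod (f z - g z) * inverse (A1_norm (bergman_kernel z)))"
    using assms by (simp add: X_dist_def X_norm_def)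
  then show ?thesis
    using cSUP_upper[OF assms(3) bdd_above_X_space_diff[OF assms(1,2)]] by simp
qed

lemma X_dist_nonneg: "0 \<le> X_dist f g"
proof (cases "f \<in> X_space \<and> g \<in> X_space")
  case True
  then have fg: "f \<in> X_space" "g \<in> X_space" by auto
  have "0 \<in> unit_disc" by simp
  from A1_norm_bergman_kernel_pos[OF this]
  have "0 \<le> cmod (f 0 - g 0) * inverse (A1_norm (bergman_kernel 0))"
    by simp
  also have "\<dots> \<le> X_dist f g"
    using \<open>0 \<in> unit_disc\<close> by (rule X_dist_upper[OF fg])
  finally show ?thesis .
next
  case False
  then show ?thesis by (auto simp: X_dist_def)
qed

lemma Metric_space_X: "Metric_space X_space X_dist"
proof
  show "0 \<le> X_dist f g" for f g
    by (rule X_dist_nonneg)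
  show "X_dist f g = X_dist g f" for f g
    by (auto simp: X_dist_def X_norm_def norm_minus_commute)
  show "X_dist f g = 0 \<longleftrightarrow> f = g" if fg: "f \<in> X_space" "g \<in> X_space" for f g
  proof
    assume 0: "X_dist f g = 0"
    have "f z = g z" for z
    proof (cases "z \<in> unit_disc")
      case True
      with X_dist_upper[OF fg True] A1_norm_bergman_kernel_pos[OF True] 0
      show ?thesis by (simp add: mult_le_0_iff)
    next
      case False
      with fg show ?thesis by (simp add: X_space_def analytic_on_disc_def)
    qed
    then show "f = g" ..
  next
    assume "f = g"
    then show "X_dist f g = 0" by (simp add: X_dist_def X_norm_def)
  qed
  show "X_dist f h \<le> X_dist f g + X_dist g h"
    if f: "f \<in> X_space" and g: "g \<in> X_space" and h: "h \<in> X_space" for f g h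
  proof -
    have "X_dist f h = (SUP z\<in>unit_disc. cmod (f z - h z) * inverse (A1_norm (bergman_kernel z)))"
      using f h by (simp add: X_dist_def X_norm_def)
    also have "\<dots> \<le> X_dist f g + X_dist g h"
    proof (rule cSUP_least)
      fix z :: complex assume z: "z \<in> unit_disc"
      have "cmod (f z - h z) * inverse (A1_norm (bergman_kernel z))
          \<le> (cmod (f z - g z) + cmod (g z - h z)) * inverse (A1_norm (bergman_kernel z))"
        using A1_norm_bergman_kernel_pos[OF z] norm_triangle_ineq[of "f z - g z" "g z - h z"]
        by (intro mult_right_mono) auto
      with X_dist_upper[OF f g z] X_dist_upper[OF g h z]
      show "cmod (f z - h z) * inverse (A1_norm (bergman_kernel z)) \<le> X_dist f g + X_dist g h"
        by (simp add: distrib_right)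
    qed simp
    finally show ?thesis .
  qed
qed

lemma topspace_X_topology: "topspace X_topology = X_space"
  unfolding X_topology_def by (rule Metric_space.topspace_mtopology[OF Metric_space_X])

end

theory Submission
  imports Defs "HOL-Complex_Analysis.Cauchy_Integral_Formula"
begin

text \<open>
  The norm \<open>A1_norm (bergman_kernel w)\<close> is comparable to \<open>1 + log (1 / (1 - \<bar>w\<bar>))\<close>, so \<open>X\<close> is a
  space of functions of logarithmic growth, and it contains the lacunary series
  \<open>f z = (\<Sum>k. 2 ^ k * z ^ 2 ^ 2 ^ k)\<close>. By Cauchy's estimate on the circle of radius \<open>1 - 1 / n\<close>,
  the \<open>n\<close>-th Taylor coefficient of \<open>h \<in> X\<close> is at most a constant times \<open>log n\<close> times the norm
  of \<open>h\<close>, whereas the Taylor coefficients of a Bloch function are bounded. The coefficient of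
  \<open>f\<close> at \<open>n = 2 ^ 2 ^ k\<close> is \<open>log 2 n\<close>, so Bloch functions stay away from \<open>f\<close>.
\<close>

section \<open>The \<open>A\<^sup>1\<close>-norm of the kernel\<close>

lemma finite_measure_area: "finite_measure area_measure"
  by standard (simp add: emeasure_area_space)

lemma sets_area_measure [simp, measurable_cong]: "sets area_measure = sets borel"
  by (simp add: area_measure_def)

lemma measure_area:
  assumes "A \<in> sets borel"
  shows "measure area_measure A = measure lborel (unit_disc \<inter> A) / measure lborel unit_disc"
  unfolding area_measure_def
proof (rule measure_uniform_measure)
  show "emeasure lborel unit_disc \<noteq> \<infinity>"
    using emeasure_lborel_ball_finite[of "0::complex" 1] by simp
  show "emeasure lborel unit_disc \<noteq> 0"
    using emeasure_lborel_ball_finite[of "0::complex" 1] content_ball_pos[of 1 "0::complex"]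
    by (auto simp: measure_def)
qed (use assms in simp)

lemma content_ball_complex:
  assumes "r \<ge> 0"
  shows "measure lborel (ball (c :: complex) r) / measure lborel unit_disc = r^2"
  using content_ball_conv_unit_ball[OF assms, of c] content_ball_pos[of 1 "0::complex"] by simp

lemma measure_area_ball:
  assumes "ball c r \<subseteq> unit_disc" "r \<ge> 0"
  shows "measure area_measure (ball c r) = r^2"
  using assms by (simp add: measure_area content_ball_complex Int_absorb1)

text \<open>The ball may stick out of the disc: this serves balls centred at
  \<open>inverse (cnj w)\<close>, which lies outside.\<close>

lemma measure_area_le_ball:
  assumes "A \<in> sets borel" "unit_disc \<inter> A \<subseteq> ball c r" "r \<ge> 0"
  shows "measure area_measure A \<le> r^2"
proof -
  have "measure lborel (unit_disc \<inter> A) \<le> measure lborel (ball c r)"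
    using assms emeasure_lborel_ball_finite[of c r]
    by (intro measure_mono_fmeasurable fmeasurableI) auto
  then have "measure area_measure A \<le> measure lborel (ball c r) / measure lborel unit_disc"
    using assms(1) content_ball_pos[of 1 "0::complex"]
    by (simp add: measure_area divide_right_mono)
  also have "\<dots> = r^2" by (rule content_ball_complex[OF assms(3)])
  finally show ?thesis .
qed

lemma cmod_bergman_kernel: "cmod (bergman_kernel w z) = 1 / (cmod (1 - cnj w * z))^2"
  by (simp add: bergman_kernel_def norm_divide norm_power)

text \<open>For \<open>i < j\<close> the centres are at least \<open>(1/2)^i / 2\<close> apart,
  while the radii add up to at most \<open>3/8 * (1/2)^i\<close>.\<close>

lemma disjoint_dyadic_balls:
  fixes u :: complex
  assumes u: "cmod u = 1" and z: "z \<in> ball ((1 - (1/2)^i) *\<^sub>R u) ((1/2)^i / 4)"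
    and z': "z \<in> ball ((1 - (1/2)^j) *\<^sub>R u) ((1/2)^j / 4)"
  shows "\<not> i < j"
proof
  assume "i < j"
  have "(1/2::real)^j \<le> (1/2)^Suc i"
    using \<open>i < j\<close> by (intro power_decreasing) auto
  then have j: "(1/2::real)^j \<le> (1/2)^i / 2" by simp
  have "dist ((1 - (1/2)^i) *\<^sub>R u) ((1 - (1/2)^j) *\<^sub>R u) = (1/2)^i - (1/2)^j"
  proof -
    have "0 < (1/2::real)^i" by simp
    then have "\<bar>(1/2::real)^j - (1/2)^i\<bar> = (1/2)^i - (1/2)^j" using j by linarith
    then show ?thesis using u by (simp add: dist_norm scaleR_diff_left[symmetric])
  qed
  moreover have "dist ((1 - (1/2)^i) *\<^sub>R u) ((1 - (1/2)^j) *\<^sub>R u)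
      < (1/2)^i / 4 + (1/2)^j / 4"
    using z z' by (intro dist_triangle_less_add) (auto simp: dist_commute)
  moreover have "0 < (1/2::real)^i" by simp
  ultimately show False using j by linarith
qed

text \<open>
  The \<open>j\<close>-th of the dyadic balls accumulating at the boundary point \<open>u = sgn w\<close> has area
  \<open>4\<^sup>-\<^sup>j / 16\<close>, and on it the modulus of the kernel is at least a multiple of \<open>4\<^sup>j\<close>.
\<close>
lemma A1_norm_bergman_kernel_ge:
  assumes w: "w \<in> unit_disc" and J: "1 - cmod w \<le> (1/2)^J"
  shows "real J / 81 \<le> A1_norm (bergman_kernel w)"
proof (cases "J = 0")
  case True
  then show ?thesis using A1_norm_bergman_kernel_pos[OF w] by simp
next
  case False
  interpret finite_measure area_measure by (rule finite_measure_area)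
  have "(1/2::real)^J \<le> (1/2)^1"
    using False by (intro power_decreasing) auto
  with J have w0: "w \<noteq> 0" by auto
  define u where "u = sgn w"
  have u: "cmod u = 1" using w0 by (simp add: u_def norm_sgn)
  have wu: "w = cmod w *\<^sub>R u" using w0 by (simp add: u_def sgn_div_norm)
  define c where "c = (\<lambda>j::nat. (1 - (1/2)^j) *\<^sub>R u)"
  define B where "B = (\<lambda>j. ball (c j) ((1/2)^j / 4))"
  \<comment> \<open>On \<open>B j\<close> the denominator \<open>1 - cnj w * z\<close> has modulus
    at most \<open>9/4 * (1/2)^j\<close>; the inverse square of this bound is the weight
    \<open>16/81 * 4^j\<close>. Times the area of \<open>B j\<close> it gives
    \<open>1/81\<close>.\<close>
  define h where "h = (\<lambda>z. \<Sum>j=1..J. (16/81 * 4^j) * indicat_real (B j) z)"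
  have B_disc: "B j \<subseteq> unit_disc" for j
  proof -
    have "(1/2::real)^j \<le> 1" by (simp add: power_le_one)
    then have "cmod (c j) = 1 - (1/2)^j" using u by (simp add: c_def)
    then have "dist (c j) 0 + (1/2)^j / 4 \<le> 1" by simp
    then show ?thesis unfolding B_def by (subst ball_subset_ball_iff) simp
  qed
  have kernel_ge: "16/81 * 4^j \<le> cmod (bergman_kernel w z)"
    if "z \<in> B j" "j \<in> {1..J}" for z j
  proof -
    have z: "z \<in> unit_disc" using that(1) B_disc by blast
    have Jj: "(1/2::real)^J \<le> (1/2)^j"
      using that by (intro power_decreasing) auto
    \<comment> \<open>The centre lies on the ray through \<open>w\<close>, so this product is real,
      and its distance to 1 splits into \<open>1 - cmod w\<close> and
      \<open>cmod w * (1/2)^j\<close>, each at most \<open>(1/2)^j\<close>.\<close>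
    have "cnj w * c j = of_real (cmod w * (1 - (1/2)^j))"
    proof -
      have "cnj u * u = 1" using u
        by (metis complex_norm_square mult.commute of_real_1 one_power2)
      then show ?thesis
        by (subst wu) (simp add: c_def scaleR_conv_of_real mult.assoc mult.left_commute)
    qed
    then have "1 - cnj w * c j = of_real (1 - cmod w * (1 - (1/2)^j))" by simp
    then have "cmod (1 - cnj w * c j) = \<bar>1 - cmod w * (1 - (1/2)^j)\<bar>"
      by (simp only: norm_of_real)
    also have "1 - cmod w * (1 - (1/2)^j) = (1 - cmod w) + cmod w * (1/2)^j"
      by (simp add: algebra_simps)
    also have "\<bar>\<dots>\<bar> = \<dots>" using w by (intro abs_of_nonneg add_nonneg_nonneg) auto
    also have "\<dots> \<le> (1/2)^j + 1 * (1/2)^j"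
      using w order_trans[OF J Jj] by (intro add_mono mult_right_mono) simp_all
    finally have 1: "cmod (1 - cnj w * c j) \<le> 2 * (1/2)^j" by simp
    have "cmod (cnj w * (c j - z)) \<le> 1 * ((1/2)^j / 4)"
      unfolding norm_mult using w that(1)
      by (intro mult_mono) (auto simp: B_def dist_norm)
    moreover have "cmod (1 - cnj w * z) \<le> cmod (1 - cnj w * c j) + cmod (cnj w * (c j - z))"
      using norm_triangle_ineq[of "1 - cnj w * c j" "cnj w * (c j - z)"]
      by (simp add: algebra_simps)
    ultimately have "cmod (1 - cnj w * z) \<le> 9/4 * (1/2)^j" using 1 by simp
    then have "cmod (1 - cnj w * z)^2 \<le> (9/4 * (1/2)^j)^2"
      by (intro power_mono) auto
    also have "\<dots> = 81/16 / 4^j"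
      by (simp add: power_mult_distrib power_divide power2_eq_square flip: power_mult_distrib)
    finally have 2: "cmod (1 - cnj w * z)^2 \<le> 81/16 / 4^j" .
    have "0 < cmod (1 - cnj w * z)"
      by (rule less_le_trans[OF _ bergman_denominator_bounds(1)[OF w z]]) (use w in simp)
    with 2 show ?thesis by (simp add: cmod_bergman_kernel field_simps)
  qed
  \<comment> \<open>By disjointness at most one summand of \<open>h\<close> is nonzero at
    \<open>z\<close>.\<close>
  have h_le: "h z \<le> cmod (bergman_kernel w z)" for z
  proof (cases "\<exists>j\<in>{1..J}. z \<in> B j")
    case True
    then obtain j where j: "j \<in> {1..J}" "z \<in> B j" by auto
    have "indicat_real (B i) z = (if i = j then 1 else 0)" for i
      using j disjoint_dyadic_balls[OF u, of z i j] disjoint_dyadic_balls[OF u, of z j i]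
      by (cases i j rule: linorder_cases) (auto simp: indicator_def B_def c_def)
    then have "h z = (\<Sum>i=1..J. if i = j then 16/81 * 4^i else 0)"
      unfolding h_def by (intro sum.cong) auto
    then have "h z = 16/81 * 4^j" using j by (subst (asm) sum.delta) auto
    with kernel_ge[OF j(2,1)] show ?thesis by simp
  next
    case False
    then have "h z = 0" by (auto simp: h_def intro!: sum.neutral)
    then show ?thesis by simp
  qed
  have "real J / 81 = (\<Sum>j=1..J. (16/81 * 4^j) * measure area_measure (B j))"
  proof -
    have "(16/81 * 4^j) * measure area_measure (B j) = 1/81" for j
    proof -
      have "measure area_measure (B j) = ((1/2)^j / 4)^2"
        unfolding B_def using B_disc[of j] by (intro measure_area_ball) (auto simp: B_def)
      also have "\<dots> = 1 / (16 * 4^j)"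
        by (simp add: power_divide power2_eq_square flip: power_mult_distrib)
      finally show ?thesis by simp
    qed
    then show ?thesis by (simp only:) simp
  qed
  also have "\<dots> = (\<integral>z. h z \<partial>area_measure)"
    unfolding h_def by (subst Bochner_Integration.integral_sum) (auto simp: B_def emeasure_eq_measure)
  also have "\<dots> \<le> A1_norm (bergman_kernel w)"
    unfolding A1_norm_def
  proof (rule integral_mono)
    show "integrable area_measure h"
      unfolding h_def
      by (intro Bochner_Integration.integrable_sum integrable_mult_right integrable_real_indicator)
         (auto simp: B_def emeasure_eq_measure)
  qed (use integrable_bergman_kernel[OF w] h_le in auto)
  finally show ?thesis .
qed

text \<open>The denominator has modulus at most 2. This covers points near the origin, where the
  dyadic bound is available only for \<open>J = 0\<close> and is trivial.\<close>

lemma A1_norm_bergman_kernel_ge_quarter: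
  assumes w: "w \<in> unit_disc"
  shows "1/4 \<le> A1_norm (bergman_kernel w)"
proof -
  interpret finite_measure area_measure by (rule finite_measure_area)
  have "(\<integral>z. 1/4 \<partial>area_measure) \<le> A1_norm (bergman_kernel w)"
    unfolding A1_norm_def
  proof (rule integral_mono_AE)
    show "AE z in area_measure. 1/4 \<le> cmod (bergman_kernel w z)"
      using AE_area_disc
    proof eventually_elim
      case (elim z)
      have "0 < cmod (1 - cnj w * z)"
        by (rule less_le_trans[OF _ bergman_denominator_bounds(1)[OF w elim]]) (use w in simp)
      moreover have "cmod (1 - cnj w * z)^2 \<le> 2^2"
        using bergman_denominator_bounds(2)[OF w elim] by (intro power_mono) auto
      ultimately show ?case by (simp add: cmod_bergman_kernel field_simps)
    qed
  qed (use integrable_bergman_kernel[OF w] in auto)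
  then show ?thesis using emeasure_area_space by (simp add: measure_def)
qed

text \<open>Selects the dyadic level of \<open>cmod (1 - cnj w * z)\<close>. The restriction
  \<open>j \<le> J\<close> is what limits the upper estimate to \<open>J + 1\<close> levels.\<close>

lemma dyadic_bracket:
  fixes t :: real
  assumes "(1/2)^J \<le> t" "t \<le> 2"
  shows "\<exists>j\<le>J. (1/2)^j \<le> t \<and> t \<le> 2 * (1/2)^j"
  using assms(1)
proof (induction J)
  case 0
  then show ?case using assms(2) by auto
next
  case (Suc J)
  show ?case
  proof (cases "(1/2)^J \<le> t")
    case True
    with Suc.IH show ?thesis by (meson le_SucI)
  next
    case False
    with Suc.prems show ?thesis by (intro exI[of _ "Suc J"]) auto
  qed
qed

text \<open>
  The set where \<open>1 - cnj w * z\<close> is at most \<open>2 * 2\<^sup>-\<^sup>j\<close> in modulus lies in a disc of comparable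
  radius about \<open>inverse (cnj w)\<close>, hence has area \<open>O (4\<^sup>-\<^sup>j)\<close>.
\<close>
lemma A1_norm_bergman_kernel_le:
  assumes w: "w \<in> unit_disc" and w2: "1/2 \<le> cmod w" and J: "(1/2)^J \<le> 1 - cmod w"
  shows "A1_norm (bergman_kernel w) \<le> 64 * (real J + 1)"
proof -
  interpret finite_measure area_measure by (rule finite_measure_area)
  define A where "A = (\<lambda>j::nat. {z. cmod (1 - cnj w * z) \<le> 2 * (1/2)^j})"
  have A_borel [measurable]: "A j \<in> sets borel" for j
    unfolding A_def by (intro borel_closed closed_Collect_le continuous_intros)
  \<comment> \<open>The sets \<open>A j\<close> are nested. The summand at the level of the
    denominator alone dominates the kernel, and overlap is harmless for an upper bound.\<close>
  define h where "h = (\<lambda>z. \<Sum>j\<le>J. 4^j * indicat_real (A j) z)"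
  have w0: "w \<noteq> 0" using w2 by auto
  have measure_A: "measure area_measure (A j) \<le> 64 / 4^j" for j
  proof -
    \<comment> \<open>Since \<open>cmod w\<close> is at least 1/2, the distance is at most
      \<open>4 * (1/2)^j\<close>; doubling the radius makes the inequality strict.\<close>
    have "A j \<subseteq> ball (inverse (cnj w)) (8 * (1/2)^j)"
    proof
      fix z assume "z \<in> A j"
      have "1 - cnj w * z = cnj w * (inverse (cnj w) - z)"
        using w0 by (simp add: field_simps)
      then have "cmod (1 - cnj w * z) = cmod w * dist (inverse (cnj w)) z"
        by (simp add: norm_mult dist_norm)
      with \<open>z \<in> A j\<close> have "cmod w * dist (inverse (cnj w)) z \<le> 2 * (1/2)^j"
        by (simp add: A_def)
      moreover have "1/2 * dist (inverse (cnj w)) z \<le> cmod w * dist (inverse (cnj w)) z"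
        using w2 by (intro mult_right_mono) auto
      moreover have "(0::real) < (1/2)^j" by simp
      ultimately have "dist (inverse (cnj w)) z < 8 * (1/2)^j" by linarith
      then show "z \<in> ball (inverse (cnj w)) (8 * (1/2)^j)" by simp
    qed
    then have "measure area_measure (A j) \<le> (8 * (1/2)^j)^2"
      by (intro measure_area_le_ball) auto
    also have "\<dots> = 64 / 4^j"
      by (simp add: power_divide power2_eq_square flip: power_mult_distrib)
    finally show ?thesis .
  qed
  have int_h: "integrable area_measure h"
    unfolding h_def
    by (intro Bochner_Integration.integrable_sum integrable_mult_right integrable_real_indicator)
       (auto simp: emeasure_eq_measure)
  have "A1_norm (bergman_kernel w) \<le> (\<integral>z. h z \<partial>area_measure)"
    unfolding A1_norm_def
  proof (rule integral_mono_AE)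
    show "AE z in area_measure. cmod (bergman_kernel w z) \<le> h z"
      using AE_area_disc
    proof eventually_elim
      case (elim z)
      let ?t = "cmod (1 - cnj w * z)"
      have "(1/2)^J \<le> ?t" "?t \<le> 2"
        using bergman_denominator_bounds[OF w elim] J by auto
      then obtain j where j: "j \<le> J" "(1/2)^j \<le> ?t" "?t \<le> 2 * (1/2)^j"
        using dyadic_bracket by blast
      have "((1/2)^j)^2 \<le> ?t^2" using j(2) by (intro power_mono) auto
      moreover have "((1/2::real)^j)^2 = 1 / 4^j"
        by (simp add: power_divide power2_eq_square flip: power_mult_distrib)
      ultimately have t: "1 / 4^j \<le> ?t^2" by simp
      have "0 < (1/2::real)^j" by simp
      with j(2) have "0 < ?t" by linarith
      with t have "cmod (bergman_kernel w z) \<le> 4^j"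
        by (simp add: cmod_bergman_kernel field_simps)
      also have "\<dots> = 4^j * indicat_real (A j) z" using j(3) by (simp add: A_def)
      also have "\<dots> \<le> h z"
        unfolding h_def
        by (rule member_le_sum[where f = "\<lambda>j. 4^j * indicat_real (A j) z"]) (use j(1) in auto)
      finally show ?case .
    qed
  qed (use integrable_bergman_kernel[OF w] int_h in auto)
  also have "\<dots> = (\<Sum>j\<le>J. 4^j * measure area_measure (A j))"
    unfolding h_def by (subst Bochner_Integration.integral_sum) (auto simp: emeasure_eq_measure)
  also have "\<dots> \<le> (\<Sum>j\<le>J. 64)"
  proof (rule sum_mono)
    show "4^j * measure area_measure (A j) \<le> 64" for j
      using measure_A[of j] by (simp add: field_simps)
  qed
  finally show ?thesis by simp
qed

section \<open>The lacunary series\<close>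

text \<open>The logarithm yields \<open>2^k\<close> at \<open>n = 2^2^k\<close> without recovering
  \<open>k\<close> from \<open>n\<close>.\<close>

definition lacunary_coeff :: "nat \<Rightarrow> real" where
  "lacunary_coeff n = (if n \<in> range (\<lambda>k. 2^2^k) then log 2 (real n) else 0)"

definition lacunary_fps :: "complex fps" where
  "lacunary_fps = Abs_fps (\<lambda>n. of_real (lacunary_coeff n))"

definition lacunary_fun :: "complex \<Rightarrow> complex" where
  "lacunary_fun z = (if z \<in> unit_disc then eval_fps lacunary_fps z else 0)"

lemma lacunary_coeff_power [simp]: "lacunary_coeff (2^2^k) = 2^k"
proof -
  have "log 2 (2 ^ 2^k :: real) = 2^k"
    by (subst log_pow_cancel) auto
  then show ?thesis by (simp add: lacunary_coeff_def)
qed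

lemma lacunary_coeff_nonneg: "0 \<le> lacunary_coeff n"
  by (auto simp: lacunary_coeff_def)

text \<open>Each doubling of the upper limit from \<open>2^c\<close> adds \<open>2^c\<close> terms
  that are at least \<open>1 / 2^(c+1)\<close>, hence at least 1/2 in total.\<close>

lemma harmonic_dyadic_block:
  "real b / 2 \<le> (\<Sum>m\<in>{2^a<..2^(a+b)}. 1 / real m)"
proof (induction b)
  case (Suc b)
  have "(\<Sum>m\<in>{2^(a+b)<..2^(a+Suc b)}. 1 / real m) \<ge> (\<Sum>m\<in>{2^(a+b)<..(2::nat)^(a+Suc b)}. 1 / 2^(a+Suc b))"
  proof (rule sum_mono)
    fix m assume m: "m \<in> {2^(a+b)<..(2::nat)^(a+Suc b)}"
    then have "real m \<le> real (2^(a+Suc b))" by (subst of_nat_le_iff) simp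
    moreover have "0 < m" using m by (auto intro: gr0I)
    ultimately show "1 / 2^(a+Suc b) \<le> 1 / real m" by (intro divide_left_mono) auto
  qed
  moreover have "(\<Sum>m\<in>{2^(a+b)<..(2::nat)^(a+Suc b)}. 1 / 2^(a+Suc b) :: real) = 1/2"
    by simp
  moreover have "(\<Sum>m\<in>{2^a<..2^(a+Suc b)}. 1 / real m)
      = (\<Sum>m\<in>{2^a<..2^(a+b)}. 1 / real m) + (\<Sum>m\<in>{2^(a+b)<..2^(a+Suc b)}. 1 / real m)"
    by (subst sum.union_disjoint[symmetric]) (auto intro!: sum.cong simp: power_increasing ivl_disj_un)
  ultimately show ?case using Suc by simp
qed simp

text \<open>
  The harmonic sum over \<open>2 ^ 2 ^ K < m \<le> 2 ^ 2 ^ (K + 1)\<close> exceeds a multiple of \<open>2 ^ K\<close>, so each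
  term of the lacunary series is dominated by its own block of the series of
  \<open>- ln (1 - r)\<close>.
\<close>
lemma lacunary_partial_le_harmonic:
  assumes r: "0 \<le> r" "r \<le> 1"
  shows "(\<Sum>k\<le>K. 2^k * r^(2^2^k)) \<le> 4 * (\<Sum>m\<in>{0<..2^2^K}. r^m / real m)"
proof (induction K)
  case 0
  have "{0<..2::nat} = {1,2}" by auto
  then show ?case using r by simp
next
  case (Suc K)
  let ?N = "2^2^K :: nat" and ?N' = "2^2^Suc K :: nat"
  \<comment> \<open>The block runs from \<open>?N\<close> to its square, so
    \<open>a = b = 2^K\<close> in the harmonic estimate; the resulting
    \<open>2^K / 2 = 2^Suc K / 4\<close> explains the factor 4.\<close>
  have NN': "?N' = 2^(2^K + 2^K)" by (simp add: mult_2)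
  have "2^Suc K / 4 = real (2^K) / 2" by simp
  also have "\<dots> \<le> (\<Sum>m\<in>{?N<..?N'}. 1 / real m)"
    unfolding NN' by (rule harmonic_dyadic_block)
  finally have "2^Suc K / 4 * r^?N' \<le> (\<Sum>m\<in>{?N<..?N'}. 1 / real m) * r^?N'"
    using r by (intro mult_right_mono) auto
  also have "\<dots> \<le> (\<Sum>m\<in>{?N<..?N'}. r^m / real m)"
    unfolding sum_distrib_right
  proof (rule sum_mono)
    fix m assume "m \<in> {?N<..?N'}"
    then have "r^?N' \<le> r^m" using r by (intro power_decreasing) auto
    then show "1 / real m * r^?N' \<le> r^m / real m" by (simp add: divide_right_mono)
  qed
  finally have "2^Suc K * r^?N' \<le> 4 * (\<Sum>m\<in>{?N<..?N'}. r^m / real m)" by simp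
  moreover have "(\<Sum>m\<in>{0<..?N'}. r^m / real m)
      = (\<Sum>m\<in>{0<..?N}. r^m / real m) + (\<Sum>m\<in>{?N<..?N'}. r^m / real m)"
    by (subst sum.union_disjoint[symmetric])
       (auto intro!: sum.cong power_increasing simp: ivl_disj_un simp del: power_Suc)
  ultimately show ?case using Suc by simp
qed

text \<open>Since \<open>k < 2^2^k\<close>, the lacunary indices below \<open>M\<close> all have
  \<open>k < M\<close>, so the sum over \<open>k \<le> M\<close> covers them.\<close>

lemma lacunary_coeff_partial_le:
  assumes r: "0 \<le> r" "r < 1"
  shows "(\<Sum>n<M. lacunary_coeff n * r^n) \<le> 4 * (- ln (1 - r))"
proof -
  let ?e = "\<lambda>k::nat. 2^2^k :: nat"
  have inj: "inj_on ?e {..M}" by (auto simp: inj_on_def)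
  have "(\<Sum>n<M. lacunary_coeff n * r^n) = (\<Sum>n\<in>{..<M} \<inter> range ?e. lacunary_coeff n * r^n)"
    by (intro sum.mono_neutral_right) (auto simp: lacunary_coeff_def)
  also have "\<dots> \<le> (\<Sum>n\<in>?e ` {..M}. lacunary_coeff n * r^n)"
  proof (rule sum_mono2)
    show "{..<M} \<inter> range ?e \<subseteq> ?e ` {..M}"
    proof clarify
      fix k assume "?e k < M"
      moreover have "k < ?e k" by (meson less_exp order.strict_trans)
      ultimately show "?e k \<in> ?e ` {..M}" by auto
    qed
  qed (use r lacunary_coeff_nonneg in auto)
  also have "\<dots> = (\<Sum>k\<le>M. 2^k * r^(?e k))"
    by (simp add: sum.reindex[OF inj])
  also have "\<dots> \<le> 4 * (\<Sum>m\<in>{0<..?e M}. r^m / real m)"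
    using r by (intro lacunary_partial_le_harmonic) auto
  also have "(\<Sum>m\<in>{0<..?e M}. r^m / real m) \<le> - ln (1 - r)"
  proof -
    \<comment> \<open>The term at \<open>m = 0\<close> is a division by zero, hence 0.\<close>
    have "(\<lambda>m. r^m / real m) sums (- ln (1 - r))"
      using sums_minus[OF ln_series'[of "- r"]] r by simp
    then show ?thesis
      using r by (intro sum_le_suminf[THEN order_trans]) (auto simp: sums_iff)
  qed
  finally show ?thesis by simp
qed

lemma
  assumes r: "0 \<le> r" "r < 1"
  shows summable_lacunary: "summable (\<lambda>n. lacunary_coeff n * r^n)"
    and suminf_lacunary_le: "(\<Sum>n. lacunary_coeff n * r^n) \<le> 4 * (- ln (1 - r))"
proof -
  show *: "summable (\<lambda>n. lacunary_coeff n * r^n)"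
    using lacunary_coeff_partial_le[OF r] lacunary_coeff_nonneg r
    by (intro summableI_nonneg_bounded[where x = "4 * (- ln (1 - r))"]) auto
  show "(\<Sum>n. lacunary_coeff n * r^n) \<le> 4 * (- ln (1 - r))"
    using lacunary_coeff_partial_le[OF r] by (intro suminf_le_const[OF *])
qed

lemma norm_lacunary_fun_le:
  assumes "z \<in> unit_disc"
  shows "cmod (lacunary_fun z) \<le> 4 * (- ln (1 - cmod z))"
proof -
  have z: "0 \<le> cmod z" "cmod z < 1" using assms by auto
  have n: "cmod (of_real (lacunary_coeff n) * z^n) = lacunary_coeff n * cmod z^n" for n
    by (simp add: norm_mult norm_power lacunary_coeff_nonneg)
  have "cmod (lacunary_fun z) \<le> (\<Sum>n. lacunary_coeff n * cmod z^n)"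
    unfolding lacunary_fun_def eval_fps_def lacunary_fps_def n[symmetric]
    using assms summable_lacunary[OF z]
    by (auto simp: n intro!: order_trans[OF summable_norm])
  also have "\<dots> \<le> 4 * (- ln (1 - cmod z))" by (rule suminf_lacunary_le[OF z])
  finally show ?thesis .
qed

lemma fps_conv_radius_lacunary: "1 \<le> fps_conv_radius lacunary_fps"
  unfolding fps_conv_radius_def
proof (rule conv_radius_geI_ex')
  fix r :: real assume "0 < r" "ereal r < 1"
  then have r: "0 \<le> r" "r < 1" by auto
  have "summable (\<lambda>n. of_real (lacunary_coeff n * r^n) :: complex)"
    using summable_lacunary[OF r] by (rule summable_of_real)
  then show "summable (\<lambda>n. fps_nth lacunary_fps n * of_real r^n)"
    by (simp add: lacunary_fps_def)
qed

lemma holomorphic_lacunary_fun: "lacunary_fun holomorphic_on unit_disc"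
proof -
  have "unit_disc \<subseteq> eball 0 (fps_conv_radius lacunary_fps)"
  proof
    fix z :: complex assume "z \<in> unit_disc"
    then have "ereal (cmod z) < 1" by simp
    also note fps_conv_radius_lacunary
    finally show "z \<in> eball 0 (fps_conv_radius lacunary_fps)" by (simp add: in_eball_iff)
  qed
  then have "eval_fps lacunary_fps holomorphic_on unit_disc"
    by (rule holomorphic_on_eval_fps)
  then show ?thesis
    by (rule holomorphic_transform) (simp add: lacunary_fun_def)
qed

lemma higher_deriv_lacunary_fun:
  "(deriv ^^ n) lacunary_fun 0 = of_real (fact n * lacunary_coeff n)"
proof -
  have "eventually (\<lambda>z::complex. z \<in> unit_disc) (nhds 0)"
    by (intro eventually_nhds_in_open) auto
  then have "eventually (\<lambda>z. eval_fps lacunary_fps z = lacunary_fun z) (nhds 0)"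
    by eventually_elim (simp add: lacunary_fun_def)
  moreover have "0 < fps_conv_radius lacunary_fps"
    by (rule less_le_trans[OF _ fps_conv_radius_lacunary]) simp
  ultimately have "lacunary_fun has_fps_expansion lacunary_fps"
    by (simp add: has_fps_expansion_def)
  from fps_nth_fps_expansion[OF this, of n] show ?thesis
    by (simp add: lacunary_fps_def field_simps)
qed

lemma lacunary_fun_in_X: "lacunary_fun \<in> X_space"
proof -
  have "cmod (lacunary_fun z) * inverse (A1_norm (bergman_kernel z)) \<le> 400"
    if z: "z \<in> unit_disc" for z
  proof -
    let ?N = "A1_norm (bergman_kernel z)"
    have "0 < 1 - cmod z" "1 - cmod z \<le> 1" using z by auto
    moreover have "(\<lambda>J. (1/2::real)^J) \<longlonglongrightarrow> 0" by (rule LIMSEQ_power_zero) simp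
    ultimately have ex: "\<exists>J. (1/2::real)^J < 1 - cmod z"
      by (intro real_arch_pow_inv) auto
    \<comment> \<open>Both logarithms are compared with this \<open>J\<close>: it bounds
      \<open>- ln (1 - cmod z)\<close> from above, and by minimality its predecessor is admissible
      in the lower bound for the kernel norm.\<close>
    define J where "J = (LEAST J. (1/2::real)^J < 1 - cmod z)"
    have J: "(1/2)^J < 1 - cmod z" unfolding J_def using ex by (rule LeastI_ex)
    have "J \<noteq> 0" using J by (cases "J = 0") auto
    then obtain I where I: "J = Suc I" by (cases J) auto
    have "\<not> (1/2)^I < 1 - cmod z"
      using not_less_Least[of I "\<lambda>J. (1/2::real)^J < 1 - cmod z"] I by (simp add: J_def)
    then have "real I / 81 \<le> ?N" by (intro A1_norm_bergman_kernel_ge[OF z]) simp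
    moreover have "1/4 \<le> ?N" by (rule A1_norm_bergman_kernel_ge_quarter[OF z])
    \<comment> \<open>\<open>J = I + 1\<close> is at most \<open>(81 + 4) * ?N\<close>, rounded up
      to 100.\<close>
    ultimately have N: "real J \<le> 100 * ?N" using I by simp
    have "ln ((1/2)^J) \<le> ln (1 - cmod z)" using J z by (intro ln_mono) auto
    then have "- ln (1 - cmod z) \<le> real J * ln 2"
      by (simp add: ln_realpow ln_div)
    also have "\<dots> \<le> real J * 1" using ln_2_less_1 by (intro mult_left_mono) auto
    finally have "cmod (lacunary_fun z) \<le> 400 * ?N"
      using norm_lacunary_fun_le[OF z] N by simp
    with A1_norm_bergman_kernel_pos[OF z] show ?thesis by (simp add: field_simps)
  qed
  then show ?thesis
    using holomorphic_lacunary_fun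
    by (auto simp: X_space_def analytic_on_disc_def lacunary_fun_def intro!: bdd_aboveI2)
qed

section \<open>Taylor coefficients\<close>

text \<open>Bernoulli's inequality with exponent \<open>n\<close> would only give 0; with exponent
  \<open>n / 2\<close> it gives 1/2, which is then squared.\<close>

lemma power_one_minus_inverse_ge:
  assumes "even n" "0 < n"
  shows "1/4 \<le> (1 - 1 / real n)^n"
proof -
  from assms obtain m where m: "n = 2 * m" "0 < m" by (auto elim: evenE)
  have "1/2 = 1 + real m * (- (1 / real n))" using m by simp
  also have "\<dots> \<le> (1 + - (1 / real n))^m"
    using m by (intro Bernoulli_inequality) (simp add: field_simps)
  finally have "1/2 \<le> (1 - 1 / real n)^m" by simp
  then have "(1/2)^2 \<le> ((1 - 1 / real n)^m)^2" by (intro power_mono) auto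
  then show ?thesis by (simp add: m power_mult power2_eq_square power_mult_distrib)
qed

lemma Cauchy_inequality_disc:
  assumes f: "f holomorphic_on unit_disc" and r: "0 < r" "r < 1"
    and B: "\<And>z. cmod z = r \<Longrightarrow> cmod (f z) \<le> B"
  shows "cmod ((deriv ^^ n) f 0) \<le> fact n * B / r^n"
proof (rule Cauchy_inequality)
  show "f holomorphic_on ball 0 r" using f r by (auto elim: holomorphic_on_subset)
  show "continuous_on (cball 0 r) f"
    using f r by (intro holomorphic_on_imp_continuous_on) (auto elim: holomorphic_on_subset)
qed (use r B in auto)

text \<open>On the circle of radius \<open>1 - 1 / n\<close> one has
  \<open>1 - cmod z = (1/2)^k\<close>, so the kernel norm is at most \<open>64 * (k + 1)\<close>;
  the factor \<open>1 / r^n\<close> costs at most another 4.\<close>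

lemma higher_deriv_X_le:
  assumes h: "h holomorphic_on unit_disc"
    and B: "\<And>z. z \<in> unit_disc \<Longrightarrow> cmod (h z) \<le> B * A1_norm (bergman_kernel z)"
    and k: "0 < k" and n: "n = 2^k"
  shows "cmod ((deriv ^^ n) h 0) \<le> fact n * (256 * B * (real k + 1))"
proof -
  define r where "r = 1 - 1 / real n"
  have "(2::real)^1 \<le> 2^k" using k by (intro power_increasing) auto
  then have n2: "real n \<ge> 2" by (simp add: n)
  have r: "1/2 \<le> r" "r < 1" using n2 by (auto simp: r_def field_simps)
  have rn: "1/4 \<le> r^n" unfolding r_def
    using k n by (intro power_one_minus_inverse_ge) auto
  have "0 \<le> B"
    using order_trans[OF norm_ge_zero B[of 0]] A1_norm_bergman_kernel_pos[of 0]
    by (simp add: zero_le_mult_iff)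
  have "cmod (h z) \<le> B * (64 * (real k + 1))" if "cmod z = r" for z
  proof -
    have z: "z \<in> unit_disc" using that r by simp
    have "A1_norm (bergman_kernel z) \<le> 64 * (real k + 1)"
      using that r z by (intro A1_norm_bergman_kernel_le) (auto simp: r_def n power_divide)
    with B[OF z] \<open>0 \<le> B\<close> show ?thesis by (meson mult_left_mono order_trans)
  qed
  with h r have "cmod ((deriv ^^ n) h 0) \<le> fact n * (B * (64 * (real k + 1))) / r^n"
    by (intro Cauchy_inequality_disc) auto
  also have "\<dots> \<le> fact n * (B * (64 * (real k + 1))) / (1/4)"
    using rn \<open>0 \<le> B\<close> by (intro divide_left_mono) auto
  finally show ?thesis by (simp add: algebra_simps)
qed

text \<open>Cauchy's estimate of order \<open>n - 1\<close> is applied to \<open>deriv g\<close>,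
  which is at most \<open>M * n\<close> on the circle of radius \<open>1 - 1 / n\<close>; this
  \<open>n\<close> turns \<open>fact (n - 1)\<close> into \<open>fact n\<close>.\<close>

lemma higher_deriv_bloch_le:
  assumes g: "g holomorphic_on unit_disc"
    and M: "\<And>z. z \<in> unit_disc \<Longrightarrow> (1 - (cmod z)^2) * cmod (deriv g z) \<le> M"
    and n: "even n" "0 < n"
  shows "cmod ((deriv ^^ n) g 0) \<le> fact n * (4 * M)"
proof -
  define r where "r = 1 - 1 / real n"
  from n have n2: "real n \<ge> 2" by (auto elim!: evenE)
  have r: "0 < r" "r < 1" using n2 by (auto simp: r_def field_simps)
  have "0 \<le> M" using order_trans[OF _ M[of 0]] by simp
  have "1/4 \<le> r^n" unfolding r_def using n by (rule power_one_minus_inverse_ge)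
  also have "\<dots> \<le> r^(n - 1)" using r by (intro power_decreasing) auto
  finally have rn: "1/4 \<le> r^(n - 1)" .
  have "cmod (deriv g z) \<le> M * real n" if "cmod z = r" for z
  proof -
    have "r^2 \<le> r" using r by (simp add: power2_eq_square mult_left_le)
    then have "1 / real n \<le> 1 - (cmod z)^2" using that by (simp add: r_def)
    then have "1 / real n * cmod (deriv g z) \<le> (1 - (cmod z)^2) * cmod (deriv g z)"
      by (intro mult_right_mono) auto
    also have "\<dots> \<le> M" using that r by (intro M) simp
    finally show ?thesis using n2 by (simp add: field_simps)
  qed
  with g r have "cmod ((deriv ^^ (n - 1)) (deriv g) 0) \<le> fact (n - 1) * (M * real n) / r^(n - 1)"
    by (intro Cauchy_inequality_disc) (auto intro: holomorphic_deriv)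
  also have "\<dots> \<le> fact (n - 1) * (M * real n) / (1/4)"
    using rn \<open>0 \<le> M\<close> by (intro divide_left_mono) auto
  also have "\<dots> = fact n * (4 * M)"
    using n by (simp add: fact_reduce[of n])
  also have "(deriv ^^ (n - 1)) (deriv g) = (deriv ^^ n) g"
    using n by (cases n) (simp_all add: funpow_swap1)
  finally show ?thesis .
qed

section \<open>Separation of the lacunary series from the Bloch functions\<close>

theorem theorem2p1:
  shows "X_topology closure_of bloch_space \<noteq> X_space"
proof
  assume "X_topology closure_of bloch_space = X_space"
  then have "lacunary_fun \<in> Metric_space.mtopology X_space X_dist closure_of bloch_space"
    using lacunary_fun_in_X by (simp add: X_topology_def)
  \<comment> \<open>The factor 256 of \<open>higher_deriv_X_le\<close> times \<open>1/1024\<close>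
    is 1/4, so the difference accounts for only about a quarter of the coefficient
    \<open>2^k\<close>.\<close>
  then obtain g where g: "g \<in> bloch_space" "g \<in> X_space" "X_dist lacunary_fun g < 1/1024"
    unfolding Metric_space.metric_closure_of[OF Metric_space_X]
    by (auto simp: Metric_space.in_mball[OF Metric_space_X]
        dest!: spec[where x = "1/1024::real"])
  have g_hol: "g holomorphic_on unit_disc"
    using g(1) by (simp add: bloch_space_def analytic_on_disc_def)
  from g(1) obtain M
    where M: "\<And>z. z \<in> unit_disc \<Longrightarrow> (1 - (cmod z)^2) * cmod (deriv g z) \<le> M"
    unfolding bloch_space_def bdd_above_def by fast
  define h where "h = (\<lambda>z. lacunary_fun z - g z)"
  have h_hol: "h holomorphic_on unit_disc"
    unfolding h_def by (intro holomorphic_intros holomorphic_lacunary_fun g_hol)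
  have h_le: "cmod (h z) \<le> 1/1024 * A1_norm (bergman_kernel z)" if z: "z \<in> unit_disc" for z
  proof -
    have "cmod (h z) * inverse (A1_norm (bergman_kernel z)) \<le> 1/1024"
      using X_dist_upper[OF lacunary_fun_in_X g(2) z] g(3) by (simp add: h_def)
    with A1_norm_bergman_kernel_pos[OF z] show ?thesis by (simp add: field_simps)
  qed
  have bound: "(2::real)^k \<le> 8 * M" for k
  proof -
    let ?n = "2^2^k :: nat"
    have "(deriv ^^ ?n) h 0 = (deriv ^^ ?n) lacunary_fun 0 - (deriv ^^ ?n) g 0"
      unfolding h_def by (rule higher_deriv_diff[OF holomorphic_lacunary_fun g_hol]) auto
    then have "cmod ((deriv ^^ ?n) lacunary_fun 0)
        \<le> cmod ((deriv ^^ ?n) h 0) + cmod ((deriv ^^ ?n) g 0)"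
      using norm_triangle_ineq[of "(deriv ^^ ?n) h 0" "(deriv ^^ ?n) g 0"] by simp
    \<comment> \<open>The exponent of 2 in \<open>?n\<close> is \<open>2^k\<close>, so the bound for
      \<open>h\<close> is linear in \<open>2^k\<close>, like the lacunary coefficient; the Bloch
      term, divided by \<open>fact ?n\<close>, does not depend on \<open>k\<close>.\<close>
    also have "\<dots> \<le> fact ?n * (256 * (1/1024) * (real (2^k) + 1)) + fact ?n * (4 * M)"
      using h_hol g_hol h_le M by (intro add_mono higher_deriv_X_le higher_deriv_bloch_le) auto
    also have "\<dots> = fact ?n * ((2^k + 1) / 4 + 4 * M)"
      by (simp add: algebra_simps)
    finally have "fact ?n * 2^k \<le> fact ?n * ((2^k + 1) / 4 + 4 * M :: real)"
      by (simp add: higher_deriv_lacunary_fun norm_mult norm_power)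
    then have "2^k \<le> (2^k + 1) / 4 + 4 * M"
      by (subst (asm) mult_le_cancel_left_pos) auto
    \<comment> \<open>For \<open>x\<close> at least 1, \<open>x - (x + 1) / 4\<close> is at least
      \<open>x / 2\<close>.\<close>
    moreover have "x \<le> 8 * M" if "x \<le> (x + 1) / 4 + 4 * M" "1 \<le> x" for x :: real
      using that by argo
    ultimately show ?thesis by simp
  qed
  obtain k where "8 * M < 2^k" using real_arch_pow[of 2 "8 * M"] by auto
  with bound[of k] show False by simp
qed

end
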